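(* Let $A$ be a finite subset of $\mathbb{R}$. Then there is an isometric embedding of $A$ in the set $T$ of all real transcendental numbers.
   Context: All subsets of $\mathbb{R}$ carry the usual metric $|x-y|$; an isometric embedding is a distance-preserving mapping. A real number is transcendental if it is not a root of any nonzero polynomial with rational coefficients. *)

theory Defs
  imports "HOL-Analysis.Analysis" "HOL-Computational_Algebra.Polynomial"
begin

definition isometric_embedding_on ::
    "'a::metric_space set \<Rightarrow> 'b::metric_space set \<Rightarrow> ('a \<Rightarrow> 'b) \<Rightarrow> bool" where
  "isometric_embedding_on A B f \<longleftrightarrow>
     f \<in> A \<rightarrow> B \<and> (\<forall>x\<in>A. \<forall>y\<in>A. dist (f x) (f y) = dist x y)"

definition transcendental_reals :: "real set" where
  "transcendental_reals = {x. \<not> algebraic x}"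

text \<open>
  The library constant \<open>algebraic\<close> is defined by polynomials with integer coefficients;
  the usual description by rational coefficients is equivalent.
\<close>

lemma transcendental_reals_iff:
  "x \<in> transcendental_reals \<longleftrightarrow>
     \<not> (\<exists>p :: real poly. (\<forall>i. coeff p i \<in> \<rat>) \<and> p \<noteq> 0 \<and> poly p x = 0)"
  by (simp add: transcendental_reals_def algebraic_altdef)

end

theory Submission
  imports Defs
begin

text \<open>
  A translation \<open>x \<mapsto> x + t\<close> maps \<open>A\<close> into the transcendental numbers unless \<open>t\<close> lies in one of
  the sets \<open>{y - a | y algebraic}\<close> with \<open>a \<in> A\<close>. Their union is countable, so some real \<open>t\<close>
  avoids it.
\<close>

text \<open>Integer polynomials are given by finite coefficient lists, hence are countably many, and
  each nonzero one has finitely many roots.\<close>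

lemma countable_algebraic: "countable {x :: 'a :: field_char_0. algebraic x}"
proof -
  define P :: "'a poly set" where "P = range (\<lambda>xs. map_poly of_int (Poly xs)) - {0}"
  have "\<exists>p\<in>P. poly p x = 0" if "algebraic x" for x
  proof -
    obtain p where p: "p \<noteq> 0" "poly (map_poly of_int p) x = 0"
      using \<open>algebraic x\<close> by (rule algebraicE')
    \<comment> \<open>In characteristic 0, \<open>of_int\<close> is injective, so nonzero
      coefficients stay nonzero.\<close>
    have "map_poly of_int p \<noteq> (0 :: 'a poly)"
      using p(1) by (simp add: poly_eq_iff coeff_map_poly)
    moreover have "map_poly of_int p \<in> range (\<lambda>xs. map_poly of_int (Poly xs) :: 'a poly)"
      by (metis Poly_coeffs rangeI)
    ultimately show ?thesis
      using p(2) unfolding P_def by blast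
  qed
  then have "{x. algebraic x} \<subseteq> (\<Union>p\<in>P. {x. poly p x = 0})"
    by blast
  moreover have "countable (\<Union>p\<in>P. {x. poly p x = 0})"
    by (intro countable_UN) (auto simp: P_def intro: countable_finite poly_roots_finite)
  ultimately show ?thesis
    by (rule countable_subset)
qed

theorem corollary5p7:
  fixes A :: "real set"
  assumes "finite A"
  shows "\<exists>f. isometric_embedding_on A transcendental_reals f"
proof -
  have "countable (\<Union>a\<in>A. (\<lambda>y. y - a) ` {y. algebraic y})"
    using assms by (intro countable_UN countable_image countable_algebraic countable_finite)
  then obtain t where t: "t \<notin> (\<Union>a\<in>A. (\<lambda>y. y - a) ` {y. algebraic y})"
    using uncountable_UNIV_real by (metis UNIV_eq_I)
  have "\<not> algebraic (x + t)" if "x \<in> A" for x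
  proof
    assume "algebraic (x + t)"
    \<comment> \<open>This puts \<open>t\<close> into the excluded union, with \<open>a = x\<close>
      and the algebraic number \<open>y = x + t\<close>.\<close>
    moreover have "t = (x + t) - x"
      by simp
    ultimately show False
      using t that by blast
  qed
  then have "isometric_embedding_on A transcendental_reals (\<lambda>x. x + t)"
    by (auto simp: isometric_embedding_on_def transcendental_reals_def dist_real_def)
  then show ?thesis
    by blast
qed

end
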